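(* Let $\epsilon\in(0,1)$ and $\delta\in(0,\frac16)$ be reals, and let $h\ge 6/\epsilon$ and $1\le p\le 2^{h(1-\epsilon)}$ be integers. Let $\mathcal{Z}$ be a set, $f:\{0,1\}^p\to\mathcal{Z}$ a function, and $g:\mathcal{A}\times\mathcal{B}\to\{0,1\}$ a (possibly partial) function on finite sets $\mathcal{A},\mathcal{B}$. If $g$ has $(\delta,h)$-hitting monochromatic rectangle-distributions, then $$\mathcal{D}^{dt}(f)\le \frac{4}{\epsilon\cdot h}\cdot\mathcal{D}^{cc}(f\circ g^p).$$
   Context: A rectangle $U\times V\subseteq\mathcal{A}\times\mathcal{B}$ is $c$-monochromatic if $g(u,v)$ is defined and equals $c$ for all $(u,v)\in U\times V$. A distribution $\sigma$ over rectangles in $\mathcal{A}\times\mathcal{B}$ is a $(\delta,h)$-hitting rectangle-distribution if for all $X\subseteq\mathcal{A}$, $Y\subseteq\mathcal{B}$ with $|X|/|\mathcal{A}|\ge 2^{-h}$ and $|Y|/|\mathcal{B}|\ge2^{-h}$, $\Pr_{R\sim\sigma}[R\cap(X\times Y)\neq\emptyset]\ge1-\delta$. $g$ has $(\delta,h)$-hitting monochromatic rectangle-distributions if there exist $(\delta,h)$-hitting rectangle-distributions $\sigma_0,\sigma_1$ with $\sigma_c$ supported on $c$-monochromatic rectangles. $f\circ g^p:\mathcal{A}^p\times\mathcal{B}^p\to\mathcal{Z}$ is $(x,y)\mapsto f(g(x_1,y_1),\dots,g(x_p,y_p))$, defined when all $g(x_i,y_i)$ are defined. $\mathcal{D}^{cc}(F)$: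 minimum depth of a deterministic two-party protocol (Alice gets $x$, Bob gets $y$) correct on the whole domain of $F$. $\mathcal{D}^{dt}(f)$: minimum depth of a deterministic decision tree computing $f$ by querying bits of its input. *)

theory Defs
  imports "HOL-Probability.Probability"
begin

section \<open>Hitting monochromatic rectangle-distributions\<close>

text \<open>
  The finite sets \<open>\<A>\<close> and \<open>\<B>\<close> are the finite types \<^typ>\<open>'a\<close> and \<^typ>\<open>'b\<close>, the truth
  values \<^const>\<open>False\<close> and \<^const>\<open>True\<close> stand for 0 and 1, and a partial function is undefined
  where it takes the value \<^const>\<open>None\<close>.
\<close>

definition rectangle :: "('a \<times> 'b) set \<Rightarrow> bool" where
  "rectangle R \<longleftrightarrow> (\<exists>U V. R = U \<times> V)"

definition monochromatic :: "('a \<times> 'b \<rightharpoonup> bool) \<Rightarrow> bool \<Rightarrow> ('a \<times> 'b) set \<Rightarrow> bool" where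
  "monochromatic g c R \<longleftrightarrow> (\<forall>(u, v) \<in> R. g (u, v) = Some c)"

definition hitting_rect_dist ::
    "real \<Rightarrow> nat \<Rightarrow> ('a::finite \<times> 'b::finite) set pmf \<Rightarrow> bool" where
  "hitting_rect_dist \<delta> h \<sigma> \<longleftrightarrow>
     (\<forall>R \<in> set_pmf \<sigma>. rectangle R) \<and>
     (\<forall>X Y. real (card X) / real CARD('a) \<ge> 2 powr (- real h) \<longrightarrow>
            real (card Y) / real CARD('b) \<ge> 2 powr (- real h) \<longrightarrow>
            measure_pmf.prob \<sigma> {R. R \<inter> (X \<times> Y) \<noteq> {}} \<ge> 1 - \<delta>)"

definition has_hitting_mono_rect_dists ::
    "real \<Rightarrow> nat \<Rightarrow> ('a::finite \<times> 'b::finite \<rightharpoonup> bool) \<Rightarrow> bool" where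
  "has_hitting_mono_rect_dists \<delta> h g \<longleftrightarrow>
     (\<forall>c. \<exists>\<sigma>. hitting_rect_dist \<delta> h \<sigma> \<and> (\<forall>R \<in> set_pmf \<sigma>. monochromatic g c R))"


section \<open>Composition\<close>

text \<open>Vectors of length \<open>p\<close> are functions on an index type \<^typ>\<open>'n\<close> with \<open>p\<close> elements.\<close>

definition compose_gadget ::
    "(('n \<Rightarrow> bool) \<Rightarrow> 'z) \<Rightarrow> ('a \<times> 'b \<rightharpoonup> bool) \<Rightarrow> (('n \<Rightarrow> 'a) \<times> ('n \<Rightarrow> 'b) \<rightharpoonup> 'z)" where
  "compose_gadget f g = (\<lambda>(x, y).
     if \<forall>i. g (x i, y i) \<noteq> None then Some (f (\<lambda>i. the (g (x i, y i)))) else None)"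


section \<open>Deterministic communication complexity\<close>

text \<open>
  At an inner node one player announces a bit depending on that player's own input; the protocol
  continues in the first subtree if the bit is 0 and in the second one if it is 1.
\<close>

datatype ('x, 'y, 'z) protocol =
    Output 'z
  | Alice "'x \<Rightarrow> bool" "('x, 'y, 'z) protocol" "('x, 'y, 'z) protocol"
  | Bob "'y \<Rightarrow> bool" "('x, 'y, 'z) protocol" "('x, 'y, 'z) protocol"

primrec run_protocol :: "('x, 'y, 'z) protocol \<Rightarrow> 'x \<Rightarrow> 'y \<Rightarrow> 'z" where
  "run_protocol (Output z) x y = z"
| "run_protocol (Alice q P0 P1) x y = (if q x then run_protocol P1 x y else run_protocol P0 x y)"
| "run_protocol (Bob q P0 P1) x y = (if q y then run_protocol P1 x y else run_protocol P0 x y)"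

primrec protocol_depth :: "('x, 'y, 'z) protocol \<Rightarrow> nat" where
  "protocol_depth (Output z) = 0"
| "protocol_depth (Alice q P0 P1) = Suc (max (protocol_depth P0) (protocol_depth P1))"
| "protocol_depth (Bob q P0 P1) = Suc (max (protocol_depth P0) (protocol_depth P1))"

definition protocol_computes :: "('x, 'y, 'z) protocol \<Rightarrow> ('x \<times> 'y \<rightharpoonup> 'z) \<Rightarrow> bool" where
  "protocol_computes P F \<longleftrightarrow> (\<forall>x y z. F (x, y) = Some z \<longrightarrow> run_protocol P x y = z)"

definition Dcc :: "('x::finite \<times> 'y::finite \<rightharpoonup> 'z) \<Rightarrow> nat" where
  "Dcc F = (LEAST d. \<exists>P. protocol_computes P F \<and> protocol_depth P = d)"

text \<open>The set of depths being minimised is never empty.\<close>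

lemma protocol_exists:
  fixes F :: "'x::finite \<times> 'y::finite \<rightharpoonup> 'z"
  shows "\<exists>P. protocol_computes P F"
proof -
  have bob: "\<exists>P :: ('x, 'y, 'z) protocol. \<forall>y \<in> T. \<forall>z. F (x, y) = Some z \<longrightarrow> (\<forall>x'. run_protocol P x' y = z)"
    for x and T :: "'y set"
    using finite[of T]
  proof (induction T rule: finite_induct)
    case (insert b T)
    then obtain P :: "('x, 'y, 'z) protocol" where
      "\<forall>y \<in> T. \<forall>z. F (x, y) = Some z \<longrightarrow> (\<forall>x'. run_protocol P x' y = z)" by blast
    then show ?case
      by (intro exI[of _ "Bob (\<lambda>y. y = b) P (Output (the (F (x, b))))"]) auto
  qed simp
  have "\<exists>P. \<forall>x \<in> S. \<forall>y z. F (x, y) = Some z \<longrightarrow> run_protocol P x y = z" for S :: "'x set"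
    using finite[of S]
  proof (induction S rule: finite_induct)
    case (insert a S)
    then obtain P where "\<forall>x \<in> S. \<forall>y z. F (x, y) = Some z \<longrightarrow> run_protocol P x y = z" by blast
    moreover obtain Q :: "('x, 'y, 'z) protocol" where "\<forall>y z. F (a, y) = Some z \<longrightarrow> (\<forall>x'. run_protocol Q x' y = z)"
      using bob[where x = a and T = UNIV] by auto
    ultimately show ?case
      by (intro exI[of _ "Alice (\<lambda>x. x = a) P Q"]) auto
  qed simp
  from this[of UNIV] show ?thesis
    by (auto simp: protocol_computes_def)
qed


section \<open>Deterministic decision tree complexity\<close>

datatype ('n, 'z) dtree =
    Answer 'z
  | Query 'n "('n, 'z) dtree" "('n, 'z) dtree"

primrec eval_dtree :: "('n, 'z) dtree \<Rightarrow> ('n \<Rightarrow> bool) \<Rightarrow> 'z" where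
  "eval_dtree (Answer z) v = z"
| "eval_dtree (Query i T0 T1) v = (if v i then eval_dtree T1 v else eval_dtree T0 v)"

primrec dtree_depth :: "('n, 'z) dtree \<Rightarrow> nat" where
  "dtree_depth (Answer z) = 0"
| "dtree_depth (Query i T0 T1) = Suc (max (dtree_depth T0) (dtree_depth T1))"

definition dtree_computes :: "('n, 'z) dtree \<Rightarrow> (('n \<Rightarrow> bool) \<Rightarrow> 'z) \<Rightarrow> bool" where
  "dtree_computes T f \<longleftrightarrow> (\<forall>v. eval_dtree T v = f v)"

definition Ddt :: "(('n::finite \<Rightarrow> bool) \<Rightarrow> 'z) \<Rightarrow> nat" where
  "Ddt f = (LEAST d. \<exists>T. dtree_computes T f \<and> dtree_depth T = d)"

text \<open>The set of depths being minimised is never empty.\<close>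

lemma dtree_exists:
  fixes f :: "('n::finite \<Rightarrow> bool) \<Rightarrow> 'z"
  shows "\<exists>T. dtree_computes T f"
proof -
  have "\<exists>T. \<forall>v. (\<forall>i. i \<notin> I \<longrightarrow> v i = w i) \<longrightarrow> eval_dtree T v = f v" for I w
    using finite[of I]
  proof (induction I arbitrary: w rule: finite_induct)
    case empty
    have "eval_dtree (Answer (f w)) v = f v" if "\<forall>i. i \<notin> {} \<longrightarrow> v i = w i" for v
    proof -
      from that have "v = w" by (intro ext) simp
      then show ?thesis by simp
    qed
    then show ?case by blast
  next
    case (insert j I)
    obtain T0 where T0:
      "\<And>v. (\<forall>i. i \<notin> I \<longrightarrow> v i = (w(j := False)) i) \<Longrightarrow> eval_dtree T0 v = f v"
      using insert.IH[of "w(j := False)"] by blast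
    obtain T1 where T1:
      "\<And>v. (\<forall>i. i \<notin> I \<longrightarrow> v i = (w(j := True)) i) \<Longrightarrow> eval_dtree T1 v = f v"
      using insert.IH[of "w(j := True)"] by blast
    have "eval_dtree (Query j T0 T1) v = f v"
      if "\<forall>i. i \<notin> insert j I \<longrightarrow> v i = w i" for v
      using that T0[of v] T1[of v] by (cases "v j") auto
    then show ?case by blast
  qed
  from this[of UNIV] show ?thesis
    by (simp add: dtree_computes_def)
qed

end

theory Submission
  imports Defs
begin

text \<open>
  A decision tree simulates the protocol while maintaining nonempty sets \<open>A\<close> and \<open>B\<close> of inputs that
  reach the current protocol node, the set \<open>I\<close> of unqueried coordinates, and the invariant that the
  projections of \<open>A\<close> and \<open>B\<close> to \<open>I\<close> are thick: every partial vector has at least a \<open>2\<^sup>-\<^sup>h\<close> fraction of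
  all possible values at each coordinate of \<open>I\<close>.
  As long as the average degree at every coordinate exceeds \<open>4p2\<^sup>-\<^sup>h\<close>, a communicated bit is followed
  towards the larger half, and thickness is restored by discarding at most half of what remains; this
  costs two bits of density. If the average degree at \<open>i\<close> is small, \<open>i\<close> is queried. By thickness, some
  monochromatic rectangle of the answered colour meets the fibres of all but a \<open>\<delta>\<close> fraction of the pairs
  of partial vectors, so \<open>A\<close> and \<open>B\<close> can be restricted to it. This keeps thickness, since the degree at
  another coordinate is computed with the \<open>i\<close>-th entry fixed, and dropping \<open>i\<close> gains at least
  \<open>\<epsilon>h - 3 \<ge> \<epsilon>h / 2\<close> bits of density. Densities are at most 1, which bounds the number of queries.
  At a leaf, thickness makes every assignment to the unqueried coordinates realisable inside \<open>A \<times> B\<close>,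
  so the protocol's output is the value of \<open>f\<close>.
\<close>

section \<open>Thick sets of vectors\<close>

text \<open>The values that may replace \<open>x i\<close> form the fibre of \<open>S\<close>
  through \<open>x\<close> in direction \<open>i\<close>, so this is a minimum degree condition. The
  empty set satisfies it, hence nonemptiness is tracked separately.\<close>

definition thick :: "real \<Rightarrow> 'n set \<Rightarrow> ('n \<Rightarrow> 'a) set \<Rightarrow> bool" where
  "thick t I S \<longleftrightarrow> (\<forall>i\<in>I. \<forall>x\<in>S. t \<le> real (card {a. x(i := a) \<in> S}))"

text \<open>Overwriting with \<open>undefined\<close> keeps the type of vectors and agrees with
  \<open>restrict\<close>, so that dropping coordinates composes with \<open>proj\<close>.\<close>

definition drop_coord :: "'n \<Rightarrow> ('n \<Rightarrow> 'a) set \<Rightarrow> ('n \<Rightarrow> 'a) set" where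
  "drop_coord i S = (\<lambda>x. x(i := undefined)) ` S"

definition proj :: "'n set \<Rightarrow> ('n \<Rightarrow> 'a) set \<Rightarrow> ('n \<Rightarrow> 'a) set" where
  "proj I A = (\<lambda>x. restrict x I) ` A"

lemma drop_coord_mono: "S \<subseteq> T \<Longrightarrow> drop_coord i S \<subseteq> drop_coord i T"
  unfolding drop_coord_def by blast

lemma drop_coord_proj: "drop_coord i (proj I A) = proj (I - {i}) A"
  unfolding drop_coord_def proj_def image_image
  by (intro image_cong) (auto simp: restrict_def)

lemma proj_restrict_coord:
  assumes "i \<in> I"
  shows "proj I {x \<in> A. x i \<in> U} = {x \<in> proj I A. x i \<in> U}"
  using assms unfolding proj_def by (auto simp: restrict_def)

lemma proj_filter:
  assumes "S \<subseteq> proj I A"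
  shows "proj I {x \<in> A. restrict x I \<in> S} = S"
  using assms unfolding proj_def by auto

lemma proj_UNIV_UNIV: "proj UNIV UNIV = UNIV"
  by (simp add: proj_def restrict_UNIV)

lemma proj_empty_iff [simp]: "proj I A = {} \<longleftrightarrow> A = {}"
  unfolding proj_def by auto

text \<open>Each fibre has at most \<open>CARD('a)\<close> elements. So dropping a coordinate never
  lowers the density, which serves the player whose degree at the queried coordinate need not be
  small.\<close>

lemma card_le_card_drop_coord:
  fixes S :: "('n::finite \<Rightarrow> 'a::finite) set"
  shows "card S \<le> CARD('a) * card (drop_coord i S)"
proof -
  have "S \<subseteq> (\<lambda>(x, a). x(i := a)) ` (drop_coord i S \<times> UNIV)"
  proof
    fix x assume "x \<in> S"
    then have "(x(i := undefined), x i) \<in> drop_coord i S \<times> UNIV"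
      by (auto simp: drop_coord_def)
    then show "x \<in> (\<lambda>(x, a). x(i := a)) ` (drop_coord i S \<times> UNIV)"
      by (rule rev_image_eqI) simp
  qed
  then have "card S \<le> card (drop_coord i S \<times> (UNIV :: 'a set))"
    by (rule surj_card_le[rotated]) simp
  then show ?thesis by (simp add: card_cartesian_product mult.commute)
qed

text \<open>A fibre in direction \<open>j \<noteq> i\<close> has a constant entry at
  \<open>i\<close>, so it survives whole whenever that entry lies in \<open>U\<close>.\<close>

lemma thick_drop_coord:
  fixes S :: "('n::finite \<Rightarrow> 'a::finite) set"
  assumes "thick t I S"
  shows "thick t (I - {i}) (drop_coord i {x \<in> S. x i \<in> U})"
  unfolding thick_def
proof (intro ballI)
  fix j y assume j: "j \<in> I - {i}" and "y \<in> drop_coord i {x \<in> S. x i \<in> U}"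
  then obtain x where x: "x \<in> S" "x i \<in> U" "y = x(i := undefined)"
    unfolding drop_coord_def by blast
  have "{a. x(j := a) \<in> S} \<subseteq> {a. y(j := a) \<in> drop_coord i {x \<in> S. x i \<in> U}}"
  proof
    fix a assume "a \<in> {a. x(j := a) \<in> S}"
    then have "x(j := a) \<in> {x \<in> S. x i \<in> U}" using j x by auto
    then have "(x(j := a))(i := undefined) \<in> drop_coord i {x \<in> S. x i \<in> U}"
      unfolding drop_coord_def by blast
    then show "a \<in> {a. y(j := a) \<in> drop_coord i {x \<in> S. x i \<in> U}}"
      using j x by (simp add: fun_upd_twist)
  qed
  then have "card {a. x(j := a) \<in> S} \<le> card {a. y(j := a) \<in> drop_coord i {x \<in> S. x i \<in> U}}"
    by (intro card_mono) simp_all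
  moreover have "t \<le> real (card {a. x(j := a) \<in> S})"
    using assms j x by (auto simp: thick_def)
  ultimately show "t \<le> real (card {a. y(j := a) \<in> drop_coord i {x \<in> S. x i \<in> U}})"
    by linarith
qed

text \<open>
  Deleting a fibre with fewer than \<open>t\<close> elements increases the functional
  \<open>card S - t * (\<Sum>i\<in>I. card (drop_coord i S))\<close>, so a maximiser of it is thick.
\<close>

lemma ex_thick_subset:
  fixes S :: "('n::finite \<Rightarrow> 'a::finite) set"
  assumes t: "0 < t"
  shows "\<exists>S' \<subseteq> S. thick t I S' \<and>
    real (card S) - t * (\<Sum>i\<in>I. real (card (drop_coord i S))) \<le> real (card S')"
proof -
  define F :: "('n \<Rightarrow> 'a) set \<Rightarrow> real" where
    "F S = real (card S) - t * (\<Sum>i\<in>I. real (card (drop_coord i S)))" for S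
  have "finite (F ` Pow S)" "F ` Pow S \<noteq> {}" by auto
  then have "Max (F ` Pow S) \<in> F ` Pow S" by (rule Max_in)
  then obtain S' where S': "S' \<subseteq> S" "F S' = Max (F ` Pow S)" by auto
  have maxi: "F Q \<le> F S'" if "Q \<subseteq> S" for Q
    unfolding S'(2) using that by (intro Max_ge) auto
  have "thick t I S'"
  proof (rule ccontr)
    assume "\<not> thick t I S'"
    then obtain i x where ix: "i \<in> I" "x \<in> S'" "real (card {a. x(i := a) \<in> S'}) < t"
      unfolding thick_def by force
    define L where "L = (\<lambda>a. x(i := a)) ` {a. x(i := a) \<in> S'}"
    have LS: "L \<subseteq> S'" unfolding L_def by auto
    have "card L \<le> card {a. x(i := a) \<in> S'}" unfolding L_def by (rule card_image_le) simp
    then have cL: "real (card L) < t" using ix(3) by linarith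
    have cS: "real (card (S' - L)) = real (card S') - real (card L)"
      using LS by (subst card_Diff_subset) (auto simp: card_mono of_nat_diff)
    \<comment> \<open>\<open>L\<close> is the entire fibre of \<open>S'\<close> through
      \<open>x\<close>, so deleting it also removes a point of the projection: fewer than
      \<open>t\<close> elements are lost and at least \<open>t\<close> is saved in the sum.\<close>
    have "x(i := undefined) \<notin> drop_coord i (S' - L)"
    proof
      assume "x(i := undefined) \<in> drop_coord i (S' - L)"
      then obtain y where y: "y \<in> S'" "y \<notin> L" "x(i := undefined) = y(i := undefined)"
        unfolding drop_coord_def by blast
      have "y = x(i := y i)"
        using y(3) by (metis fun_upd_triv fun_upd_upd)
      then show False using y unfolding L_def by (metis (mono_tags, lifting) image_eqI mem_Collect_eq)
    qed
    moreover have "x(i := undefined) \<in> drop_coord i S'"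
      using ix(2) unfolding drop_coord_def by blast
    ultimately have "drop_coord i (S' - L) \<subset> drop_coord i S'"
      using drop_coord_mono[of "S' - L" S' i] by blast
    then have "card (drop_coord i (S' - L)) < card (drop_coord i S')"
      by (intro psubset_card_mono) simp_all
    then have "real (card (drop_coord i (S' - L))) + 1 \<le> real (card (drop_coord i S'))"
      by linarith
    moreover have "(\<Sum>j\<in>I - {i}. real (card (drop_coord j (S' - L)))) \<le>
        (\<Sum>j\<in>I - {i}. real (card (drop_coord j S')))"
      by (intro sum_mono) (auto intro!: card_mono drop_coord_mono)
    ultimately have "(\<Sum>j\<in>I. real (card (drop_coord j (S' - L)))) + 1 \<le>
        (\<Sum>j\<in>I. real (card (drop_coord j S')))"
      using ix(1) by (simp add: sum.remove[of I i])
    then have "t * ((\<Sum>j\<in>I. real (card (drop_coord j (S' - L)))) + 1) \<le>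
        t * (\<Sum>j\<in>I. real (card (drop_coord j S')))"
      using t by (intro mult_left_mono) auto
    then have "F S' < F (S' - L)"
      unfolding F_def using cS cL by (simp add: algebra_simps)
    moreover have "F (S' - L) \<le> F S'" using S'(1) by (intro maxi) blast
    ultimately show False by simp
  qed
  moreover have "F S' \<le> real (card S')"
    unfolding F_def using t by (simp add: sum_nonneg)
  moreover have "F S \<le> F S'" by (rule maxi) simp
  ultimately show ?thesis using S'(1) unfolding F_def by (intro exI[of _ S']) auto
qed

text \<open>The average degree at \<open>i\<close> is \<open>card S / card (drop_coord i S)\<close>.
  If it is at least \<open>2 * CARD('n) * t\<close>, each of the at most \<open>CARD('n)\<close>
  terms of the loss is at most \<open>card S / (2 * CARD('n))\<close>.\<close>

lemma ex_thick_half: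
  fixes S :: "('n::finite \<Rightarrow> 'a::finite) set"
  assumes t: "0 < t"
    and avg: "\<And>i. i \<in> I \<Longrightarrow> 2 * real CARD('n) * t * real (card (drop_coord i S)) \<le> real (card S)"
  shows "\<exists>S' \<subseteq> S. thick t I S' \<and> real (card S) \<le> 2 * real (card S')"
proof -
  have n: "real CARD('n) > 0" by simp
  have "t * (\<Sum>i\<in>I. real (card (drop_coord i S))) = (\<Sum>i\<in>I. t * real (card (drop_coord i S)))"
    by (simp add: sum_distrib_left)
  also have "\<dots> \<le> (\<Sum>i\<in>I. real (card S) / (2 * real CARD('n)))"
    using avg n by (intro sum_mono) (simp add: field_simps)
  also have "\<dots> = real (card I) * (real (card S) / (2 * real CARD('n)))" by simp
  also have "\<dots> \<le> real CARD('n) * (real (card S) / (2 * real CARD('n)))"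
    by (intro mult_right_mono) (auto intro: card_mono)
  also have "\<dots> = real (card S) / 2" by simp
  finally have "t * (\<Sum>i\<in>I. real (card (drop_coord i S))) \<le> real (card S) / 2" .
  moreover obtain S' where "S' \<subseteq> S" "thick t I S'"
    "real (card S) - t * (\<Sum>i\<in>I. real (card (drop_coord i S))) \<le> real (card S')"
    using ex_thick_subset[OF t] by blast
  ultimately show ?thesis by (intro exI[of _ S']) auto
qed


section \<open>Hitting many fibres at once\<close>

lemma ex_ge_expectation:
  fixes \<sigma> :: "'c::finite pmf" and H :: "'c \<Rightarrow> real"
  assumes "m \<le> measure_pmf.expectation \<sigma> H"
  shows "\<exists>R\<in>set_pmf \<sigma>. m \<le> H R"
proof (rule ccontr)
  assume "\<not> ?thesis"
  then have less: "H R < m" if "R \<in> set_pmf \<sigma>" for R using that by force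
  \<comment> \<open>The maximum over the finite support keeps the inequality strict under
    integration.\<close>
  define M where "M = Max (H ` set_pmf \<sigma>)"
  have fin: "finite (H ` set_pmf \<sigma>)" "H ` set_pmf \<sigma> \<noteq> {}" by (auto simp: set_pmf_not_empty)
  have "M < m" unfolding M_def using fin less by simp
  have "measure_pmf.expectation \<sigma> H \<le> M"
    using fin unfolding M_def
    by (intro measure_pmf.integral_le_const integrable_measure_pmf_finite)
       (auto simp: AE_measure_pmf_iff)
  then show False using assms \<open>M < m\<close> by simp
qed

text \<open>Thickness makes each pair of fibres large enough to be hit with probability
  \<open>1 - \<delta>\<close>. By linearity of expectation a single rectangle hits that fraction of
  all pairs, and then that fraction on each side.\<close>

lemma hitting_rect_dist_projections:
  fixes S :: "('n::finite \<Rightarrow> 'a::finite) set" and T :: "('n \<Rightarrow> 'b::finite) set"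
  assumes \<sigma>: "hitting_rect_dist \<delta> h \<sigma>"
    and S: "thick (2 powr (- real h) * real CARD('a)) {i} S" "S \<noteq> {}"
    and T: "thick (2 powr (- real h) * real CARD('b)) {i} T" "T \<noteq> {}"
  shows "\<exists>U V. U \<times> V \<in> set_pmf \<sigma> \<and>
    (1 - \<delta>) * real (card (drop_coord i S)) \<le> real (card (drop_coord i {x \<in> S. x i \<in> U})) \<and>
    (1 - \<delta>) * real (card (drop_coord i T)) \<le> real (card (drop_coord i {y \<in> T. y i \<in> V}))"
proof -
  define D where "D = drop_coord i S \<times> drop_coord i T"
  \<comment> \<open>\<open>ext w\<close> is the rectangle of values at \<open>i\<close> that
    complete the two partial vectors of \<open>w\<close>.\<close>
  define ext where "ext = (\<lambda>(x, y). {a. x(i := a) \<in> S} \<times> {b. y(i := b) \<in> T})"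
  define H where "H R = real (card {w \<in> D. R \<inter> ext w \<noteq> {}})" for R
  have H_sum: "H R = (\<Sum>w\<in>D. indicator {R. R \<inter> ext w \<noteq> {}} R)" for R
    unfolding H_def by (simp add: indicator_def sum.If_cases Int_def)
  have prob: "1 - \<delta> \<le> measure_pmf.prob \<sigma> {R. R \<inter> ext w \<noteq> {}}" if wD: "w \<in> D" for w
  proof -
    obtain x y where w: "w = (x(i := undefined), y(i := undefined))" "x \<in> S" "y \<in> T"
      using wD unfolding D_def drop_coord_def by blast
    have "2 powr (- real h) \<le> real (card {a. x(i := a) \<in> S}) / real CARD('a)"
      using S(1) w(2) by (auto simp: thick_def field_simps)
    moreover have "2 powr (- real h) \<le> real (card {b. y(i := b) \<in> T}) / real CARD('b)"
      using T(1) w(3) by (auto simp: thick_def field_simps)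
    ultimately show ?thesis
      using \<sigma> unfolding hitting_rect_dist_def ext_def w by simp
  qed
  have "(1 - \<delta>) * real (card D) = (\<Sum>w\<in>D. 1 - \<delta>)" by simp
  also have "\<dots> \<le> (\<Sum>w\<in>D. measure_pmf.prob \<sigma> {R. R \<inter> ext w \<noteq> {}})"
    by (intro sum_mono prob)
  also have "\<dots> = measure_pmf.expectation \<sigma> H"
    unfolding H_sum by (subst Bochner_Integration.integral_sum) (auto intro: integrable_measure_pmf_finite)
  finally obtain R where R: "R \<in> set_pmf \<sigma>" "(1 - \<delta>) * real (card D) \<le> H R"
    using ex_ge_expectation by blast
  have "rectangle R" using \<sigma> R(1) by (simp add: hitting_rect_dist_def)
  then obtain U V where UV: "R = U \<times> V" by (auto simp: rectangle_def)
  let ?S = "drop_coord i {x \<in> S. x i \<in> U}" and ?T = "drop_coord i {y \<in> T. y i \<in> V}"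
  \<comment> \<open>Since \<open>R\<close> is a product, the two halves of a hit pair are completed
    separately, in \<open>U\<close> and in \<open>V\<close>.\<close>
  have "{w \<in> D. R \<inter> ext w \<noteq> {}} \<subseteq> ?S \<times> ?T"
  proof
    fix w assume "w \<in> {w \<in> D. R \<inter> ext w \<noteq> {}}"
    then have wD: "w \<in> D" and we: "R \<inter> ext w \<noteq> {}" by auto
    obtain x y where w: "w = (x(i := undefined), y(i := undefined))"
      using wD unfolding D_def drop_coord_def by blast
    obtain a b where ab: "a \<in> U" "b \<in> V" "x(i := a) \<in> S" "y(i := b) \<in> T"
      using we unfolding w ext_def UV by auto
    have "x(i := a) \<in> {x \<in> S. x i \<in> U}" "y(i := b) \<in> {y \<in> T. y i \<in> V}"
      using ab by simp_all
    then have "(x(i := a))(i := undefined) \<in> ?S" "(y(i := b))(i := undefined) \<in> ?T"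
      unfolding drop_coord_def by blast+
    then show "w \<in> ?S \<times> ?T" unfolding w by simp
  qed
  then have "card {w \<in> D. R \<inter> ext w \<noteq> {}} \<le> card ?S * card ?T"
    by (subst card_cartesian_product[symmetric]) (intro card_mono, auto)
  then have "H R \<le> real (card ?S * card ?T)" unfolding H_def by (simp only: of_nat_le_iff)
  with R(2) have le: "(1 - \<delta>) * (real (card (drop_coord i S)) * real (card (drop_coord i T)))
      \<le> real (card ?S) * real (card ?T)"
    by (simp add: D_def card_cartesian_product)
  have pos: "0 < real (card (drop_coord i S))" "0 < real (card (drop_coord i T))"
    using S(2) T(2) by (auto simp: drop_coord_def card_gt_0_iff)
  have ST: "real (card ?S) \<le> real (card (drop_coord i S))" "real (card ?T) \<le> real (card (drop_coord i T))"
    by (auto intro!: card_mono drop_coord_mono)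
  \<comment> \<open>To isolate one factor, the other is bounded by its full size, which then
    cancels.\<close>
  have "(1 - \<delta>) * real (card (drop_coord i S)) * real (card (drop_coord i T))
      \<le> real (card ?S) * real (card (drop_coord i T))"
    using le mult_left_mono[OF ST(2), of "real (card ?S)"] by simp
  moreover have "(1 - \<delta>) * real (card (drop_coord i T)) * real (card (drop_coord i S))
      \<le> real (card ?T) * real (card (drop_coord i S))"
    using le mult_right_mono[OF ST(1), of "real (card ?T)"] by (simp add: mult_ac)
  ultimately have "(1 - \<delta>) * real (card (drop_coord i S)) \<le> real (card ?S)"
    "(1 - \<delta>) * real (card (drop_coord i T)) \<le> real (card ?T)"
    using pos by simp_all
  then show ?thesis using R(1) unfolding UV by blast
qed


section \<open>The simulation\<close>

definition log_density :: "'n set \<Rightarrow> ('n::finite \<Rightarrow> 'a::finite) set \<Rightarrow> real" where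
  "log_density I A = log 2 (real (card (proj I A)) / real CARD('a) ^ card I)"

lemma card_proj_pos:
  fixes A :: "('n::finite \<Rightarrow> 'a::finite) set"
  shows "A \<noteq> {} \<Longrightarrow> 0 < card (proj I A)"
  by (simp add: card_gt_0_iff)

lemma log_density_nonpos:
  fixes A :: "('n::finite \<Rightarrow> 'a::finite) set"
  assumes "A \<noteq> {}"
  shows "log_density I A \<le> 0"
proof -
  have "card (proj I A) \<le> card (PiE I (\<lambda>_. UNIV :: 'a set))"
    by (intro card_mono) (auto simp: proj_def)
  then have "card (proj I A) \<le> CARD('a) ^ card I" by (simp add: card_PiE)
  then have "real (card (proj I A)) \<le> real CARD('a) ^ card I"
    by (metis of_nat_le_iff of_nat_power)
  then show ?thesis
    unfolding log_density_def using card_proj_pos[OF assms, of I]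
    by (simp add: log_le_zero_cancel_iff)
qed

lemma log_density_UNIV: "log_density UNIV (UNIV :: ('n::finite \<Rightarrow> 'a::finite) set) = 0"
proof -
  have "proj UNIV (UNIV :: ('n \<Rightarrow> 'a) set) = UNIV" by (rule proj_UNIV_UNIV)
  moreover have "CARD('n \<Rightarrow> 'a) = CARD('a) ^ CARD('n)" by (simp add: card_fun)
  ultimately show ?thesis unfolding log_density_def by simp
qed

text \<open>The factor 4 combines one halving for the communicated bit and one for restoring
  thickness.\<close>

lemma log_density_shrink:
  fixes A A' :: "('n::finite \<Rightarrow> 'a::finite) set"
  assumes "A \<noteq> {}" "real (card (proj I A)) \<le> 4 * real (card (proj I A'))"
  shows "log_density I A - 2 \<le> log_density I A'"
proof -
  have p: "0 < card (proj I A)" using assms(1) by (rule card_proj_pos)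
  have "log_density I A - 2 = log 2 (real (card (proj I A)) / real CARD('a) ^ card I / 4)"
  proof -
    have "log 2 4 = (2::real)" using log_nat_power[of 2 2 2] by simp
    moreover have "0 < real (card (proj I A)) / real CARD('a) ^ card I" using p by simp
    ultimately show ?thesis unfolding log_density_def by (subst log_divide_pos) simp_all
  qed
  also have "\<dots> \<le> log_density I A'"
    unfolding log_density_def using assms(2) p by (simp add: field_simps)
  finally show ?thesis .
qed

text \<open>Dropping \<open>i\<close> divides the number of all partial vectors by
  \<open>CARD('a)\<close>, so \<open>r\<close> bounds from below the factor by which the density
  changes.\<close>

lemma log_density_drop:
  fixes A A' :: "('n::finite \<Rightarrow> 'a::finite) set"
  assumes "A \<noteq> {}" "i \<in> I" "0 < r"
    and "r * real (card (proj I A)) \<le> real CARD('a) * real (card (proj (I - {i}) A'))"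
  shows "log_density I A + log 2 r \<le> log_density (I - {i}) A'"
proof -
  have p: "0 < card (proj I A)" using assms(1) by (rule card_proj_pos)
  have c: "card I = Suc (card (I - {i}))"
    using assms(2) by (metis card.remove finite)
  have "log_density I A + log 2 r = log 2 (real (card (proj I A)) / real CARD('a) ^ card I * r)"
    unfolding log_density_def using p assms(3)
    by (intro log_mult_pos[symmetric] divide_pos_pos zero_less_power) simp_all
  also have "\<dots> \<le> log 2 (real (card (proj (I - {i}) A')) / real CARD('a) ^ card (I - {i}))"
    using assms(3,4) p unfolding c by (intro log_mono) (simp_all add: field_simps)
  finally show ?thesis unfolding log_density_def .
qed

text \<open>The constant 4 is twice that of \<open>ex_thick_half\<close>: passing to the larger bit
  class may halve \<open>proj I A\<close>, while the projections to \<open>I - {i}\<close> do not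
  grow.\<close>

lemma ex_thick_half_same_bit:
  fixes A :: "('n::finite \<Rightarrow> 'c::finite) set" and q :: "('n \<Rightarrow> 'c) \<Rightarrow> bool"
  assumes A: "A \<noteq> {}" and t: "0 < t"
    and avg: "\<And>i. i \<in> I \<Longrightarrow>
      4 * real CARD('n) * t * real (card (proj (I - {i}) A)) \<le> real (card (proj I A))"
  shows "\<exists>b. \<exists>A' \<subseteq> A. (\<forall>x\<in>A'. q x = b) \<and> A' \<noteq> {} \<and> thick t I (proj I A') \<and>
    log_density I A - 2 \<le> log_density I A'"
proof -
  have "proj I A = proj I {x \<in> A. q x} \<union> proj I {x \<in> A. \<not> q x}"
    unfolding proj_def by auto
  then have "card (proj I A) \<le> card (proj I {x \<in> A. q x}) + card (proj I {x \<in> A. \<not> q x})"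
    by (simp add: card_Un_le)
  then have "\<exists>b. card (proj I A) \<le> 2 * card (proj I {x \<in> A. q x = b})"
    by (cases "card (proj I {x \<in> A. q x}) \<le> card (proj I {x \<in> A. \<not> q x})")
       (auto intro: exI[of _ True] exI[of _ False])
  then obtain b where b: "card (proj I A) \<le> 2 * card (proj I {x \<in> A. q x = b})" by blast
  define Q where "Q = {x \<in> A. q x = b}"
  have Q: "real (card (proj I A)) \<le> 2 * real (card (proj I Q))"
    using b unfolding Q_def by linarith
  have "2 * real CARD('n) * t * real (card (drop_coord i (proj I Q))) \<le> real (card (proj I Q))"
    if "i \<in> I" for i
  proof -
    have "card (proj (I - {i}) Q) \<le> card (proj (I - {i}) A)"
      by (intro card_mono) (auto simp: proj_def Q_def)
    then have "2 * (2 * real CARD('n) * t * real (card (proj (I - {i}) Q))) \<le>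
        4 * real CARD('n) * t * real (card (proj (I - {i}) A))"
      using t by simp
    also have "\<dots> \<le> 2 * real (card (proj I Q))" using avg[OF that] Q by linarith
    finally show ?thesis unfolding drop_coord_proj by linarith
  qed
  from ex_thick_half[OF t this] obtain S' where
    S': "S' \<subseteq> proj I Q" "thick t I S'" "real (card (proj I Q)) \<le> 2 * real (card S')"
    by blast
  \<comment> \<open>The bit may depend on entries outside \<open>I\<close>, so the thick set is
    pulled back to full vectors of the chosen bit class.\<close>
  define A' where "A' = {x \<in> Q. restrict x I \<in> S'}"
  have p: "proj I A' = S'" unfolding A'_def using S'(1) by (rule proj_filter)
  have le: "real (card (proj I A)) \<le> 4 * real (card (proj I A'))"
    using Q S'(3) unfolding p by linarith
  then have "A' \<noteq> {}" using card_proj_pos[OF A, of I] by (auto simp: proj_def)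
  then show ?thesis
    using log_density_shrink[OF A le] S'(2) p
    by (intro exI[of _ b] exI[of _ A']) (auto simp: A'_def Q_def)
qed

text \<open>The fraction \<open>5 / 6\<close> is what \<open>1 - \<delta>\<close> guarantees for
  \<open>\<delta> < 1 / 6\<close>; the density loses no more than this factor.\<close>

lemma log_density_query:
  fixes A A' :: "('n::finite \<Rightarrow> 'c::finite) set"
  assumes "A \<noteq> {}" "i \<in> I" "5 / 6 * real (card (proj (I - {i}) A)) \<le> real (card (proj (I - {i}) A'))"
  shows "log_density I A + log 2 (5 / 6) \<le> log_density (I - {i}) A'"
proof (rule log_density_drop)
  have "card (proj I A) \<le> CARD('c) * card (proj (I - {i}) A)"
    using card_le_card_drop_coord[of "proj I A" i] unfolding drop_coord_proj .
  then have "real (card (proj I A)) \<le> real CARD('c) * real (card (proj (I - {i}) A))"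
    by (metis of_nat_le_iff of_nat_mult)
  also have "\<dots> \<le> real CARD('c) * (6 / 5 * real (card (proj (I - {i}) A')))"
    using assms(3) by (intro mult_left_mono) auto
  finally show "5 / 6 * real (card (proj I A)) \<le> real CARD('c) * real (card (proj (I - {i}) A'))"
    by simp
qed (use assms in auto)

text \<open>Since \<open>CARD('n) * 2 powr (- h)\<close> is at most \<open>2 powr (- e)\<close>, the
  average degree is below \<open>4 * 2 powr (- e) * CARD('c)\<close>. Dropping \<open>i\<close>
  therefore gains a factor \<open>2 powr e / 4\<close>, and restricting to the rectangle costs
  \<open>5 / 6\<close>.\<close>

lemma log_density_query_low_degree:
  fixes A A' :: "('n::finite \<Rightarrow> 'c::finite) set" and h :: nat
  assumes "A \<noteq> {}" "i \<in> I" "5 / 6 * real (card (proj (I - {i}) A)) \<le> real (card (proj (I - {i}) A'))"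
    and n: "real CARD('n) \<le> 2 powr (real h - e)"
    and low: "real (card (proj I A)) <
      4 * real CARD('n) * (2 powr (- real h) * real CARD('c)) * real (card (proj (I - {i}) A))"
  shows "log_density I A + (e + log 2 (5 / 24)) \<le> log_density (I - {i}) A'"
proof -
  have "2 powr e * real CARD('n) * 2 powr (- real h) \<le> 2 powr e * 2 powr (real h - e) * 2 powr (- real h)"
    using n by (intro mult_right_mono mult_left_mono) auto
  also have "\<dots> = 1" by (simp flip: powr_add)
  finally have le1: "2 powr e * real CARD('n) * 2 powr (- real h) \<le> 1" .
  have "2 powr e * (5 / 24) * real (card (proj I A)) \<le> 2 powr e * (5 / 24) *
      (4 * real CARD('n) * (2 powr (- real h) * real CARD('c)) * real (card (proj (I - {i}) A)))"
    using low by (intro mult_left_mono) auto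
  also have "\<dots> = (2 powr e * real CARD('n) * 2 powr (- real h)) *
      (real CARD('c) * (5 / 6 * real (card (proj (I - {i}) A))))"
    by (simp add: algebra_simps)
  also have "\<dots> \<le> 1 * (real CARD('c) * real (card (proj (I - {i}) A')))"
    using le1 assms(3) by (intro mult_mono) auto
  finally have "log_density I A + log 2 (2 powr e * (5 / 24)) \<le> log_density (I - {i}) A'"
    using assms(1,2) by (intro log_density_drop) auto
  moreover have "log 2 (2 powr e * (5 / 24)) = e + log 2 (5 / 24)"
    by (subst log_mult_pos) simp_all
  ultimately show ?thesis by (simp only:)
qed

section \<open>The invariant of the simulation and its behaviour under queries\<close>

locale hitting_gadget =
  fixes g :: "'a::finite \<times> 'b::finite \<rightharpoonup> bool" and \<delta> :: real and h :: nat
  assumes delta: "\<delta> < 1 / 6" and hit: "has_hitting_mono_rect_dists \<delta> h g"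
begin

definition ta :: real where "ta = 2 powr (- real h) * real CARD('a)"
definition tb :: real where "tb = 2 powr (- real h) * real CARD('b)"

text \<open>
  The set \<open>I\<close> holds the unqueried coordinates; the queried ones have been answered according to \<open>w\<close>.
\<close>

definition state ::
    "'n set \<Rightarrow> ('n::finite \<Rightarrow> bool) \<Rightarrow> ('n \<Rightarrow> 'a) set \<Rightarrow> ('n \<Rightarrow> 'b) set \<Rightarrow> bool" where
  "state I w A B \<longleftrightarrow> A \<noteq> {} \<and> B \<noteq> {} \<and> thick ta I (proj I A) \<and> thick tb I (proj I B) \<and>
     (\<forall>x\<in>A. \<forall>y\<in>B. \<forall>i. i \<notin> I \<longrightarrow> g (x i, y i) = Some (w i))"

lemma t_pos: "0 < ta" "0 < tb"
  unfolding ta_def tb_def by simp_all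

text \<open>There is a hitting distribution for each colour, so either answer \<open>c\<close> can
  be imposed. Keeping a positive fraction of the nonempty projections keeps both sets
  nonempty.\<close>

lemma state_query:
  assumes st: "state I w A B" and i: "i \<in> I"
  obtains A' B' where "A' \<subseteq> A" "B' \<subseteq> B" "state (I - {i}) (w(i := c)) A' B'"
    "5 / 6 * real (card (proj (I - {i}) A)) \<le> real (card (proj (I - {i}) A'))"
    "5 / 6 * real (card (proj (I - {i}) B)) \<le> real (card (proj (I - {i}) B'))"
proof -
  obtain \<sigma> where \<sigma>: "hitting_rect_dist \<delta> h \<sigma>" "\<forall>R\<in>set_pmf \<sigma>. monochromatic g c R"
    using hit unfolding has_hitting_mono_rect_dists_def by blast
  have ne: "A \<noteq> {}" "B \<noteq> {}" and th: "thick ta I (proj I A)" "thick tb I (proj I B)"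
    using st unfolding state_def by auto
  have "thick ta {i} (proj I A)" "thick tb {i} (proj I B)"
    using th i unfolding thick_def by auto
  then obtain U V where UV: "U \<times> V \<in> set_pmf \<sigma>"
    "(1 - \<delta>) * real (card (proj (I - {i}) A)) \<le> real (card (drop_coord i {x \<in> proj I A. x i \<in> U}))"
    "(1 - \<delta>) * real (card (proj (I - {i}) B)) \<le> real (card (drop_coord i {y \<in> proj I B. y i \<in> V}))"
    using hitting_rect_dist_projections[OF \<sigma>(1), of i "proj I A" "proj I B"] ne
    unfolding ta_def tb_def drop_coord_proj by auto
  define A' B' where "A' = {x \<in> A. x i \<in> U}" and "B' = {y \<in> B. y i \<in> V}"
  have eq: "drop_coord i {x \<in> proj I A. x i \<in> U} = proj (I - {i}) A'"
    "drop_coord i {y \<in> proj I B. y i \<in> V} = proj (I - {i}) B'"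
    unfolding A'_def B'_def proj_restrict_coord[OF i, symmetric] drop_coord_proj by simp_all
  have mono: "5 / 6 * real n \<le> (1 - \<delta>) * real n" for n
    using delta by (intro mult_right_mono) auto
  have card: "5 / 6 * real (card (proj (I - {i}) A)) \<le> real (card (proj (I - {i}) A'))"
    "5 / 6 * real (card (proj (I - {i}) B)) \<le> real (card (proj (I - {i}) B'))"
    using UV(2,3) mono unfolding eq by (meson order_trans)+
  have ne': "A' \<noteq> {}" "B' \<noteq> {}"
    using card card_proj_pos[OF ne(1), of "I - {i}"] card_proj_pos[OF ne(2), of "I - {i}"]
    by (auto simp: proj_def)
  have "g (u, v) = Some c" if "u \<in> U" "v \<in> V" for u v
    using bspec[OF \<sigma>(2) UV(1)] that by (simp add: monochromatic_def)
  moreover have "g (x j, y j) = Some (w j)" if "x \<in> A" "y \<in> B" "j \<notin> I" for x y j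
    using st that unfolding state_def by blast
  ultimately have "\<forall>x\<in>A'. \<forall>y\<in>B'. \<forall>j. j \<notin> I - {i} \<longrightarrow> g (x j, y j) = Some ((w(i := c)) j)"
    unfolding A'_def B'_def by simp
  then have "state (I - {i}) (w(i := c)) A' B'"
    unfolding state_def using ne' thick_drop_coord[OF th(1), of i U] thick_drop_coord[OF th(2), of i V]
    unfolding eq by blast
  then show ?thesis using card by (intro that) (auto simp: A'_def B'_def)
qed

text \<open>The coordinates of \<open>I\<close> are fixed one after another with the desired answers
  \<open>v i\<close>; any pair of vectors in the final nonempty sets is a witness.\<close>

lemma state_realises:
  assumes "state I w A B" "\<And>i. i \<notin> I \<Longrightarrow> v i = w i"
  shows "\<exists>x\<in>A. \<exists>y\<in>B. \<forall>i. g (x i, y i) = Some (v i)"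
  using finite[of I] assms
proof (induction I arbitrary: w A B rule: finite_induct)
  case empty
  then show ?case unfolding state_def by fastforce
next
  case (insert i I)
  have "insert i I - {i} = I" using insert.hyps by simp
  then obtain A' B' where *: "A' \<subseteq> A" "B' \<subseteq> B" "state I (w(i := v i)) A' B'"
    using state_query[OF insert.prems(1) insertI1, where c = "v i"] by metis
  have "\<exists>x\<in>A'. \<exists>y\<in>B'. \<forall>i. g (x i, y i) = Some (v i)"
    using insert.prems(2) by (intro insert.IH[OF *(3)]) auto
  then show ?case using *(1,2) by blast
qed

text \<open>The right-hand side is a budget: two bits for each remaining level of the protocol plus
  the density already missing on both sides. Every query draws \<open>G\<close> from it.\<close>

definition simulable :: "real \<Rightarrow> (('n::finite \<Rightarrow> bool) \<Rightarrow> 'z) \<Rightarrow> nat \<Rightarrow>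
    'n set \<Rightarrow> ('n \<Rightarrow> bool) \<Rightarrow> ('n \<Rightarrow> 'a) set \<Rightarrow> ('n \<Rightarrow> 'b) set \<Rightarrow> bool" where
  "simulable G f d I w A B \<longleftrightarrow> (\<exists>T. (\<forall>v. (\<forall>i. i \<notin> I \<longrightarrow> v i = w i) \<longrightarrow> eval_dtree T v = f v) \<and>
     real (dtree_depth T) * G \<le> 2 * real d - log_density I A - log_density I B)"

text \<open>Correctness is relative to \<open>A\<close> and \<open>B\<close> because a subprotocol
  is reliable only on the inputs that reach its node.\<close>

definition correct_on :: "(('n \<Rightarrow> bool) \<Rightarrow> 'z) \<Rightarrow> ('n \<Rightarrow> 'a, 'n \<Rightarrow> 'b, 'z) protocol \<Rightarrow>
    ('n \<Rightarrow> 'a) set \<Rightarrow> ('n \<Rightarrow> 'b) set \<Rightarrow> bool" where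
  "correct_on f P A B \<longleftrightarrow> (\<forall>x\<in>A. \<forall>y\<in>B. \<forall>v. (\<forall>i. g (x i, y i) = Some (v i)) \<longrightarrow>
     run_protocol P x y = f v)"

lemma correct_on_mono:
  "correct_on f P A B \<Longrightarrow> A' \<subseteq> A \<Longrightarrow> B' \<subseteq> B \<Longrightarrow> correct_on f P A' B'"
  unfolding correct_on_def by blast

text \<open>Whatever the answer, the two densities together rise by at least \<open>e - 3\<close>
  bits, which pays for the query.\<close>

lemma simulable_query:
  fixes f :: "('n::finite \<Rightarrow> bool) \<Rightarrow> 'z"
  assumes n: "real CARD('n) \<le> 2 powr (real h - e)"
    and st: "state I w A B" and i: "i \<in> I"
    and low: "real (card (proj I A)) < 4 * real CARD('n) * ta * real (card (proj (I - {i}) A)) \<or>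
      real (card (proj I B)) < 4 * real CARD('n) * tb * real (card (proj (I - {i}) B))"
    and sub: "\<And>c A' B'. A' \<subseteq> A \<Longrightarrow> B' \<subseteq> B \<Longrightarrow> state (I - {i}) (w(i := c)) A' B' \<Longrightarrow>
      simulable (e - 3) f d (I - {i}) (w(i := c)) A' B'"
  shows "simulable (e - 3) f d I w A B"
proof -
  have ne: "A \<noteq> {}" "B \<noteq> {}" using st unfolding state_def by auto
  have "\<exists>T. (\<forall>v. (\<forall>j. j \<notin> I - {i} \<longrightarrow> v j = (w(i := c)) j) \<longrightarrow> eval_dtree T v = f v) \<and>
     (real (dtree_depth T) + 1) * (e - 3) \<le> 2 * real d - log_density I A - log_density I B" for c
  proof -
    obtain A' B' where AB: "A' \<subseteq> A" "B' \<subseteq> B" "state (I - {i}) (w(i := c)) A' B'"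
      "5 / 6 * real (card (proj (I - {i}) A)) \<le> real (card (proj (I - {i}) A'))"
      "5 / 6 * real (card (proj (I - {i}) B)) \<le> real (card (proj (I - {i}) B'))"
      using state_query[OF st i] .
    have gain: "log_density I A + log_density I B + (e + log 2 (5 / 24)) + log 2 (5 / 6) \<le>
        log_density (I - {i}) A' + log_density (I - {i}) B'"
      using low
    proof
      assume "real (card (proj I A)) < 4 * real CARD('n) * ta * real (card (proj (I - {i}) A))"
      then have "log_density I A + (e + log 2 (5 / 24)) \<le> log_density (I - {i}) A'"
        using log_density_query_low_degree[OF ne(1) i AB(4) n] unfolding ta_def by blast
      with log_density_query[OF ne(2) i AB(5)] show ?thesis by linarith
    next
      assume "real (card (proj I B)) < 4 * real CARD('n) * tb * real (card (proj (I - {i}) B))"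
      then have "log_density I B + (e + log 2 (5 / 24)) \<le> log_density (I - {i}) B'"
        using log_density_query_low_degree[OF ne(2) i AB(5) n] unfolding tb_def by blast
      with log_density_query[OF ne(1) i AB(4)] show ?thesis by linarith
    qed
    \<comment> \<open>Both restrictions to the rectangle and the factor 4 of the degree bound give
      \<open>25 / 144\<close>, which exceeds \<open>1 / 8\<close>.\<close>
    have "- 3 = log 2 (1 / 8 :: real)"
      using log_nat_power[of 2 2 3] by (simp add: log_divide)
    also have "\<dots> \<le> log 2 (5 / 24 * (5 / 6))" by simp
    also have "\<dots> = log 2 (5 / 24) + log 2 (5 / 6)" by (rule log_mult_pos) auto
    finally have const: "- 3 \<le> log 2 (5 / 24) + log 2 (5 / 6 :: real)" .
    obtain T where T: "\<forall>v. (\<forall>j. j \<notin> I - {i} \<longrightarrow> v j = (w(i := c)) j) \<longrightarrow> eval_dtree T v = f v"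
      "real (dtree_depth T) * (e - 3) \<le>
        2 * real d - log_density (I - {i}) A' - log_density (I - {i}) B'"
      using sub[OF AB(1-3)] unfolding simulable_def by blast
    have "(real (dtree_depth T) + 1) * (e - 3) = real (dtree_depth T) * (e - 3) + (e - 3)"
      by (simp add: algebra_simps)
    then have "(real (dtree_depth T) + 1) * (e - 3) \<le> 2 * real d - log_density I A - log_density I B"
      using T(2) gain const by linarith
    then show ?thesis using T(1) by blast
  qed
  then obtain T where T:
    "\<And>c v. (\<forall>j. j \<notin> I - {i} \<longrightarrow> v j = (w(i := c)) j) \<Longrightarrow> eval_dtree (T c) v = f v"
    "\<And>c. (real (dtree_depth (T c)) + 1) * (e - 3) \<le> 2 * real d - log_density I A - log_density I B"
    by metis
  have "eval_dtree (Query i (T False) (T True)) v = f v" if "\<forall>j. j \<notin> I \<longrightarrow> v j = w j" for v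
    using that T(1)[of v "v i"] by (cases "v i") auto
  moreover have "real (dtree_depth (Query i (T False) (T True))) * (e - 3) \<le>
      2 * real d - log_density I A - log_density I B"
    using T(2)[of False] T(2)[of True] by (simp add: max_def algebra_simps)
  ultimately show ?thesis unfolding simulable_def by blast
qed

text \<open>Coordinates of low degree are queried while the protocol node stays fixed. Each query
  shrinks \<open>I\<close>, so eventually all degrees are high.\<close>

lemma simulable_if_high_degree:
  fixes f :: "('n::finite \<Rightarrow> bool) \<Rightarrow> 'z"
  assumes n: "real CARD('n) \<le> 2 powr (real h - e)"
    and high: "\<And>I w A B. state I w A B \<Longrightarrow> correct_on f P A B \<Longrightarrow>
      (\<And>i. i \<in> I \<Longrightarrow> 4 * real CARD('n) * ta * real (card (proj (I - {i}) A)) \<le> real (card (proj I A))) \<Longrightarrow>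
      (\<And>i. i \<in> I \<Longrightarrow> 4 * real CARD('n) * tb * real (card (proj (I - {i}) B)) \<le> real (card (proj I B))) \<Longrightarrow>
      simulable (e - 3) f d I w A B"
    and "state I w A B" "correct_on f P A B"
  shows "simulable (e - 3) f d I w A B"
  using assms(3,4)
proof (induction "card I" arbitrary: I w A B rule: less_induct)
  case less
  show ?case
  proof (cases "\<exists>i\<in>I. real (card (proj I A)) < 4 * real CARD('n) * ta * real (card (proj (I - {i}) A)) \<or>
      real (card (proj I B)) < 4 * real CARD('n) * tb * real (card (proj (I - {i}) B))")
    case True
    then obtain i where i: "i \<in> I"
      "real (card (proj I A)) < 4 * real CARD('n) * ta * real (card (proj (I - {i}) A)) \<or>
       real (card (proj I B)) < 4 * real CARD('n) * tb * real (card (proj (I - {i}) B))" by blast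
    show ?thesis
    proof (rule simulable_query[OF n less.prems(1) i])
      fix c A' B' assume "A' \<subseteq> A" "B' \<subseteq> B" and st: "state (I - {i}) (w(i := c)) A' B'"
      then have "correct_on f P A' B'" using correct_on_mono less.prems(2) by blast
      moreover have "card (I - {i}) < card I" using i(1) by (intro psubset_card_mono) auto
      ultimately show "simulable (e - 3) f d (I - {i}) (w(i := c)) A' B'"
        using less.hyps st by blast
    qed
  next
    case False
    then show ?thesis using less.prems by (intro high) (auto simp: not_less)
  qed
qed

text \<open>One more level adds two to \<open>2 * d\<close>, exactly the density a bit may cost. The
  form \<open>d < d'\<close> allows for a deeper sibling subtree.\<close>

lemma simulable_step:
  assumes "simulable G f d I w A' B'"
    and "log_density I A + log_density I B - 2 \<le> log_density I A' + log_density I B'" "d < d'"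
  shows "simulable G f d' I w A B"
proof -
  have "real d + 1 \<le> real d'" using assms(3) by linarith
  moreover obtain T where "\<forall>v. (\<forall>i. i \<notin> I \<longrightarrow> v i = w i) \<longrightarrow> eval_dtree T v = f v"
     "real (dtree_depth T) * G \<le> 2 * real d - log_density I A' - log_density I B'"
    using assms(1) unfolding simulable_def by blast
  ultimately show ?thesis
    unfolding simulable_def using assms(2) by (intro exI[of _ T]) auto
qed

lemma simulable_protocol:
  fixes f :: "('n::finite \<Rightarrow> bool) \<Rightarrow> 'z"
  assumes n: "real CARD('n) \<le> 2 powr (real h - e)"
    and "state I w A B" "correct_on f P A B"
  shows "simulable (e - 3) f (protocol_depth P) I w A B"
  using assms(2,3)
proof (induction P arbitrary: I w A B)
  case (Output z)
  have "f v = z" if "\<forall>i. i \<notin> I \<longrightarrow> v i = w i" for v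
    using state_realises[OF Output.prems(1), of v] that Output.prems(2)
    unfolding correct_on_def by auto
  \<comment> \<open>The budget is nonnegative, as a tree of depth 0 requires.\<close>
  moreover have "log_density I A \<le> 0" "log_density I B \<le> 0"
    using Output.prems(1) by (auto simp: state_def log_density_nonpos)
  ultimately show ?case
    unfolding simulable_def by (intro exI[of _ "Answer z"]) auto
next
  case (Alice q P0 P1)
  show ?case
  proof (rule simulable_if_high_degree[OF n _ Alice.prems])
    fix I w A B
    assume st: "state I w A B" and corr: "correct_on f (Alice q P0 P1) A B"
      and avg: "\<And>i. i \<in> I \<Longrightarrow> 4 * real CARD('n) * ta * real (card (proj (I - {i}) A)) \<le> real (card (proj I A))"
    obtain b A' where A': "A' \<subseteq> A" "\<forall>x\<in>A'. q x = b" "A' \<noteq> {}" "thick ta I (proj I A')"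
      "log_density I A - 2 \<le> log_density I A'"
      using ex_thick_half_same_bit[where q = q, OF _ t_pos(1) avg] st unfolding state_def by metis
    have st': "state I w A' B" using st A' unfolding state_def by blast
    \<comment> \<open>The branch \<open>b\<close> is fixed by the sizes of the two classes, so
      following it takes no query.\<close>
    have "correct_on f (if b then P1 else P0) A' B"
      using corr A'(1,2) unfolding correct_on_def by fastforce
    then have "simulable (e - 3) f (protocol_depth (if b then P1 else P0)) I w A' B"
      using Alice.IH[OF st'] by (cases b) auto
    then show "simulable (e - 3) f (protocol_depth (Alice q P0 P1)) I w A B"
      by (rule simulable_step) (use A'(5) in auto)
  qed
next
  case (Bob q P0 P1)
  show ?case
  proof (rule simulable_if_high_degree[OF n _ Bob.prems])
    fix I w A B
    assume st: "state I w A B" and corr: "correct_on f (Bob q P0 P1) A B"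
      and avg: "\<And>i. i \<in> I \<Longrightarrow> 4 * real CARD('n) * tb * real (card (proj (I - {i}) B)) \<le> real (card (proj I B))"
    obtain b B' where B': "B' \<subseteq> B" "\<forall>y\<in>B'. q y = b" "B' \<noteq> {}" "thick tb I (proj I B')"
      "log_density I B - 2 \<le> log_density I B'"
      using ex_thick_half_same_bit[where q = q, OF _ t_pos(2) avg] st unfolding state_def by metis
    have st': "state I w A B'" using st B' unfolding state_def by blast
    have "correct_on f (if b then P1 else P0) A B'"
      using corr B'(1,2) unfolding correct_on_def by fastforce
    then have "simulable (e - 3) f (protocol_depth (if b then P1 else P0)) I w A B'"
      using Bob.IH[OF st'] by (cases b) auto
    then show "simulable (e - 3) f (protocol_depth (Bob q P0 P1)) I w A B"
      by (rule simulable_step) (use B'(5) in auto)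
  qed
qed

section \<open>The initial state and the resulting bound\<close>

lemma state_UNIV: "state UNIV w UNIV (UNIV :: ('n::finite \<Rightarrow> 'b) set)"
proof -
  have "2 powr (- real h) \<le> 2 powr (0::real)" by (rule powr_mono) auto
  then have "2 powr (- real h) \<le> (1::real)" by simp
  then have "ta \<le> real CARD('a)" "tb \<le> real CARD('b)"
    unfolding ta_def tb_def by (auto intro!: mult_left_le_one_le)
  then show ?thesis
    unfolding state_def thick_def proj_UNIV_UNIV by auto
qed

text \<open>At the root both densities are 1, so the whole budget is twice the depth of an optimal
  protocol.\<close>

lemma Ddt_le_Dcc:
  fixes f :: "('n::finite \<Rightarrow> bool) \<Rightarrow> 'z"
  assumes n: "real CARD('n) \<le> 2 powr (real h - e)" and e: "3 \<le> e"
  shows "real (Ddt f) * (e - 3) \<le> 2 * real (Dcc (compose_gadget f g))"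
proof -
  have "\<exists>d P. protocol_computes P (compose_gadget f g) \<and> protocol_depth P = d"
    using protocol_exists by blast
  then have "\<exists>P. protocol_computes P (compose_gadget f g) \<and> protocol_depth P = Dcc (compose_gadget f g)"
    unfolding Dcc_def by (rule LeastI_ex)
  then obtain P where P: "protocol_computes P (compose_gadget f g)"
    "protocol_depth P = Dcc (compose_gadget f g)" by blast
  have "correct_on f P UNIV UNIV"
    using P(1) unfolding correct_on_def protocol_computes_def compose_gadget_def by auto
  \<comment> \<open>With \<open>I = UNIV\<close> nothing has been answered yet, so any vector can
    stand for \<open>w\<close>.\<close>
  from simulable_protocol[OF n state_UNIV this, of undefined]
  obtain T where T: "dtree_computes T f"
    "real (dtree_depth T) * (e - 3) \<le> 2 * real (Dcc (compose_gadget f g))"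
    unfolding simulable_def P(2) log_density_UNIV dtree_computes_def by auto
  have "Ddt f \<le> dtree_depth T"
    unfolding Ddt_def using T(1) by (intro Least_le) blast
  then have "real (Ddt f) * (e - 3) \<le> real (dtree_depth T) * (e - 3)"
    using e by (intro mult_right_mono) auto
  then show ?thesis using T(2) by linarith
qed

end

theorem theorem3:
  fixes \<epsilon> \<delta> :: real and h p :: nat
    and f :: "('n::finite \<Rightarrow> bool) \<Rightarrow> 'z"
    and g :: "'a::finite \<times> 'b::finite \<rightharpoonup> bool"
  assumes "0 < \<epsilon>" "\<epsilon> < 1"
    and "0 < \<delta>" "\<delta> < 1 / 6"
    and "real h \<ge> 6 / \<epsilon>"
    and "1 \<le> p" "real p \<le> 2 powr (real h * (1 - \<epsilon>))"
    and "CARD('n) = p"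
    and "has_hitting_mono_rect_dists \<delta> h g"
  shows "real (Ddt f) \<le> 4 / (\<epsilon> * real h) * real (Dcc (compose_gadget f g))"
proof -
  interpret hitting_gadget g \<delta> h
    by (rule hitting_gadget.intro[OF assms(4,9)])
  define e where "e = \<epsilon> * real h"
  have e: "6 \<le> e" using assms(1,5) unfolding e_def by (simp add: field_simps)
  have "real CARD('n) \<le> 2 powr (real h - e)"
    using assms(7,8) unfolding e_def by (simp add: algebra_simps)
  then have "real (Ddt f) * (e - 3) \<le> 2 * real (Dcc (compose_gadget f g))"
    using e by (intro Ddt_le_Dcc) auto
  \<comment> \<open>From \<open>e \<ge> 6\<close> follows \<open>e - 3 \<ge> e / 2\<close>, which
    turns the factor 2 into 4.\<close>
  moreover have "real (Ddt f) * (e / 2) \<le> real (Ddt f) * (e - 3)"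
    using e by (intro mult_left_mono) auto
  ultimately have "real (Ddt f) * e \<le> 4 * real (Dcc (compose_gadget f g))" by linarith
  then show ?thesis using e unfolding e_def[symmetric] by (simp add: field_simps)
qed

end
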